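(* Let $\mathbf{v}_i=[v_{i,j}:j\in\mathbb{N}]$, $i=1,\dots,n$, be linearly independent elements of $c_0(\mathbb{N})$ and let $\mathbf{y}\in\mathbb{R}^n\setminus\{\mathbf{0}\}$. Put $\mathcal{V}:=\mathrm{span}\{\mathbf{v}_1,\dots,\mathbf{v}_n\}$, $\mathcal{M}_{\mathbf{y}}:=\{\mathbf{x}\in\ell_1(\mathbb{N}):\sum_{j\in\mathbb{N}}v_{i,j}x_j=y_i,\ i=1,\dots,n\}$, and let $\mathrm{S}(\mathbf{y})$ be the set of all $\mathbf{x}\in\mathcal{M}_{\mathbf{y}}$ with $\|\mathbf{x}\|_1=\inf\{\|\mathbf{w}\|_1:\mathbf{w}\in\mathcal{M}_{\mathbf{y}}\}$. Suppose $\hat{\mathbf{v}}\in\mathcal{V}$ satisfies $$(\|\hat{\mathbf{v}}\|_\infty\,\mathrm{co}(\Omega(\hat{\mathbf{v}})))\cap\mathcal{M}_{\mathbf{y}}\neq\emptyset .$$ Then for every extreme point $\hat{\mathbf{x}}$ of $\mathrm{S}(\mathbf{y})$ there exist a positive integer $M\le\mathrm{rank}(\mathbf{V}_{\hat{\mathbf{v}}})$, real numbers $\hat\alpha_j\neq0$, $j=1,\dots,M$, with $\sum_{j=1}^M|\hat\alpha_j|=\|\hat{\mathbf{v}}\|_\infty$, and indices $k_j\in\mathbb{N}(\hat{\mathbf{v}})$, $j=1,\dots,M$, such that $$\hat{\mathbf{x}}=\sum_{j=1}^M\hat\alpha_jK(\cdot,k_j).$$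
   Context: $\ell_1(\mathbb{N})$ is the space of absolutely summable real sequences with norm $\|\cdot\|_1$; $c_0(\mathbb{N})$ is the space of real sequences converging to $0$ with norm $\|\cdot\|_\infty$. $K:\mathbb{N}\times\mathbb{N}\to\mathbb{R}$ is $K(i,j)=1$ if $i=j$ and $0$ otherwise, so $K(\cdot,j)$ is the $j$-th unit sequence. For $\mathbf{v}=[v_j:j\in\mathbb{N}]\in c_0(\mathbb{N})$: $\mathbb{N}(\mathbf{v}):=\{j\in\mathbb{N}:|v_j|=\|\mathbf{v}\|_\infty\}$ (finite if $\mathbf{v}\neq\mathbf{0}$), $n(\mathbf{v})$ is its cardinality, $\Omega(\mathbf{v}):=\{\mathrm{sign}(v_j)K(\cdot,j):j\in\mathbb{N}(\mathbf{v})\}\subset\ell_1(\mathbb{N})$, and $\mathrm{co}$ denotes convex hull. For $\mathbf{v}\neq\mathbf{0}$, writing $\mathbb{N}(\mathbf{v})=\{m_1,\dots,m_{n(\mathbf{v})}\}$, put $\mathbf{V}_{\mathbf{v}}:=[v_{i,m_j}]_{1\le i\le n,\,1\le j\le n(\mathbf{v})}\in\mathbb{R}^{n\times n(\mathbf{v})}$. (The hypothesis on $\hat{\mathbf{v}}$ together with $\mathbf{y}\ne\mathbf{0}$ forces $\hat{\mathbf{v}}\neq\mathbf{0}$.) *)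

theory Defs
  imports "HOL-Analysis.Analysis" "Jordan_Normal_Form.DL_Rank"
begin

no_notation Finite_Cartesian_Product.vec_nth (infixl \<open>$\<close> 90)

typedef c0 = "{v :: nat \<Rightarrow> real. v \<longlonglongrightarrow> 0}"
  morphisms c0_nth Abs_c0
  by (rule exI[of _ "\<lambda>_. 0"]) simp

setup_lifting type_definition_c0

lemma c0_eqI: "(\<And>j. c0_nth u j = c0_nth v j) \<Longrightarrow> u = v"
  by transfer auto

lemma null_seq_bdd_above: "v \<longlonglongrightarrow> (0::real) \<Longrightarrow> bdd_above (range (\<lambda>j. \<bar>v j\<bar>))"
  by (rule bounded_imp_bdd_above)
    (use convergent_imp_bounded in \<open>force simp: bounded_iff\<close>)

instantiation c0 :: real_vector
begin

lift_definition zero_c0 :: c0 is "\<lambda>_. 0" by simp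

lift_definition plus_c0 :: "c0 \<Rightarrow> c0 \<Rightarrow> c0" is "\<lambda>u v j. u j + v j"
  by (rule tendsto_add_zero)

lift_definition uminus_c0 :: "c0 \<Rightarrow> c0" is "\<lambda>v j. - v j"
  using tendsto_minus by fastforce

lift_definition minus_c0 :: "c0 \<Rightarrow> c0 \<Rightarrow> c0" is "\<lambda>u v j. u j - v j"
  using tendsto_diff by fastforce

lift_definition scaleR_c0 :: "real \<Rightarrow> c0 \<Rightarrow> c0" is "\<lambda>c v j. c * v j"
  by (rule tendsto_mult_right_zero)

instance
  by standard (transfer; auto simp: algebra_simps)+

end

instantiation c0 :: real_normed_vector
begin

lift_definition norm_c0 :: "c0 \<Rightarrow> real" is "\<lambda>v. SUP j. \<bar>v j\<bar>" .

definition dist_c0 :: "c0 \<Rightarrow> c0 \<Rightarrow> real" where "dist_c0 u v = norm (u - v)"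

definition sgn_c0 :: "c0 \<Rightarrow> c0" where "sgn_c0 v = v /\<^sub>R norm v"

definition uniformity_c0 :: "(c0 \<times> c0) filter" where
  "uniformity_c0 = (INF e\<in>{0<..}. principal {(u, v). dist u v < e})"

definition open_c0 :: "c0 set \<Rightarrow> bool" where
  "open_c0 S = (\<forall>u\<in>S. \<forall>\<^sub>F (u', v) in uniformity. u' = u \<longrightarrow> v \<in> S)"

instance
proof
  fix a :: real and u v :: c0
  show "norm u = 0 \<longleftrightarrow> u = 0"
  proof transfer
    fix u :: "nat \<Rightarrow> real" assume u: "u \<longlonglongrightarrow> 0"
    then have le: "\<bar>u j\<bar> \<le> (SUP j. \<bar>u j\<bar>)" for j
      by (auto intro!: cSUP_upper null_seq_bdd_above)
    show "(SUP j. \<bar>u j\<bar>) = 0 \<longleftrightarrow> u = (\<lambda>_. 0)"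
    proof
      assume z: "(SUP j. \<bar>u j\<bar>) = 0"
      have "u j = 0" for j using le[of j] unfolding z by simp
      then show "u = (\<lambda>_. 0)" by auto
    qed auto
  qed
  show "norm (u + v) \<le> norm u + norm v"
  proof transfer
    fix u v :: "nat \<Rightarrow> real" assume uv: "u \<longlonglongrightarrow> 0" "v \<longlonglongrightarrow> 0"
    then have "\<bar>u j\<bar> \<le> (SUP j. \<bar>u j\<bar>)" "\<bar>v j\<bar> \<le> (SUP j. \<bar>v j\<bar>)" for j
      by (auto intro!: cSUP_upper null_seq_bdd_above)
    then have "\<bar>u j + v j\<bar> \<le> (SUP j. \<bar>u j\<bar>) + (SUP j. \<bar>v j\<bar>)" for j
      using abs_triangle_ineq[of "u j" "v j"] by (meson add_mono order_trans)
    then show "(SUP j. \<bar>u j + v j\<bar>) \<le> (SUP j. \<bar>u j\<bar>) + (SUP j. \<bar>v j\<bar>)"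
      by (intro cSUP_least) auto
  qed
  show "norm (a *\<^sub>R u) = \<bar>a\<bar> * norm u"
  proof transfer
    fix a :: real and u :: "nat \<Rightarrow> real" assume u: "u \<longlonglongrightarrow> 0"
    show "(SUP j. \<bar>a * u j\<bar>) = \<bar>a\<bar> * (SUP j. \<bar>u j\<bar>)"
      using u
      by (subst continuous_at_Sup_mono)
        (auto intro!: monoI mult_left_mono continuous_intros null_seq_bdd_above
          simp: image_comp abs_mult)
  qed
qed (rule dist_c0_def sgn_c0_def uniformity_c0_def open_c0_def)+

end

typedef ell1 = "{x :: nat \<Rightarrow> real. summable (\<lambda>j. \<bar>x j\<bar>)}"
  morphisms ell1_nth Abs_ell1
  by (rule exI[of _ "\<lambda>_. 0"]) simp

setup_lifting type_definition_ell1

lemma ell1_eqI: "(\<And>j. ell1_nth x j = ell1_nth z j) \<Longrightarrow> x = z"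
  by transfer auto

lemma summable_abs_add:
  fixes x z :: "nat \<Rightarrow> real"
  assumes "summable (\<lambda>j. \<bar>x j\<bar>)" "summable (\<lambda>j. \<bar>z j\<bar>)"
  shows "summable (\<lambda>j. \<bar>x j + z j\<bar>)"
  by (rule summable_comparison_test'[OF summable_add[OF assms], of 0])
    (simp add: abs_triangle_ineq)

instantiation ell1 :: real_vector
begin

lift_definition zero_ell1 :: ell1 is "\<lambda>_. 0" by simp

lift_definition plus_ell1 :: "ell1 \<Rightarrow> ell1 \<Rightarrow> ell1" is "\<lambda>x z j. x j + z j"
  by (rule summable_abs_add)

lift_definition uminus_ell1 :: "ell1 \<Rightarrow> ell1" is "\<lambda>x j. - x j" by simp

lift_definition minus_ell1 :: "ell1 \<Rightarrow> ell1 \<Rightarrow> ell1" is "\<lambda>x z j. x j - z j"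
  subgoal for x z using summable_abs_add[of x "\<lambda>j. - z j"] by simp
  done

lift_definition scaleR_ell1 :: "real \<Rightarrow> ell1 \<Rightarrow> ell1" is "\<lambda>c x j. c * x j"
  by (simp add: abs_mult summable_mult)

instance
  by standard (transfer; auto simp: algebra_simps)+

end

instantiation ell1 :: real_normed_vector
begin

lift_definition norm_ell1 :: "ell1 \<Rightarrow> real" is "\<lambda>x. \<Sum>j. \<bar>x j\<bar>" .

definition dist_ell1 :: "ell1 \<Rightarrow> ell1 \<Rightarrow> real" where "dist_ell1 x z = norm (x - z)"

definition sgn_ell1 :: "ell1 \<Rightarrow> ell1" where "sgn_ell1 x = x /\<^sub>R norm x"

definition uniformity_ell1 :: "(ell1 \<times> ell1) filter" where
  "uniformity_ell1 = (INF e\<in>{0<..}. principal {(x, z). dist x z < e})"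

definition open_ell1 :: "ell1 set \<Rightarrow> bool" where
  "open_ell1 S = (\<forall>x\<in>S. \<forall>\<^sub>F (x', z) in uniformity. x' = x \<longrightarrow> z \<in> S)"

instance
proof
  fix a :: real and x z :: ell1
  show "norm x = 0 \<longleftrightarrow> x = 0"
    by transfer (auto simp: suminf_eq_zero_iff)
  show "norm (x + z) \<le> norm x + norm z"
  proof transfer
    fix x z :: "nat \<Rightarrow> real"
    assume s: "summable (\<lambda>j. \<bar>x j\<bar>)" "summable (\<lambda>j. \<bar>z j\<bar>)"
    have "(\<Sum>j. \<bar>x j + z j\<bar>) \<le> (\<Sum>j. \<bar>x j\<bar> + \<bar>z j\<bar>)"
      by (intro suminf_le abs_triangle_ineq summable_abs_add summable_add s)
    then show "(\<Sum>j. \<bar>x j + z j\<bar>) \<le> (\<Sum>j. \<bar>x j\<bar>) + (\<Sum>j. \<bar>z j\<bar>)"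
      by (simp add: suminf_add s)
  qed
  show "norm (a *\<^sub>R x) = \<bar>a\<bar> * norm x"
    by transfer (simp add: abs_mult suminf_mult)
qed (rule dist_ell1_def sgn_ell1_def uniformity_ell1_def open_ell1_def)+

end

lift_definition unit_ell1 :: "nat \<Rightarrow> ell1" is "\<lambda>j i. if i = j then 1 else 0"
  subgoal for j by (rule summable_finite[of "{j}"]) auto
  done

definition duality_pairing :: "c0 \<Rightarrow> ell1 \<Rightarrow> real" where
  "duality_pairing v x = (\<Sum>j. c0_nth v j * ell1_nth x j)"

definition interpolants :: "nat \<Rightarrow> (nat \<Rightarrow> c0) \<Rightarrow> real Matrix.vec \<Rightarrow> ell1 set" where
  "interpolants n v y = {x. \<forall>i<n. duality_pairing (v i) x = y $ i}"

definition min_norm_interpolants :: "nat \<Rightarrow> (nat \<Rightarrow> c0) \<Rightarrow> real Matrix.vec \<Rightarrow> ell1 set" where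
  "min_norm_interpolants n v y =
     {x \<in> interpolants n v y. norm x = (INF w\<in>interpolants n v y. norm w)}"

definition peak_indices :: "c0 \<Rightarrow> nat set" where
  "peak_indices v = {j. \<bar>c0_nth v j\<bar> = norm v}"

definition peak_units :: "c0 \<Rightarrow> ell1 set" where
  "peak_units v = {sgn (c0_nth v j) *\<^sub>R unit_ell1 j | j. j \<in> peak_indices v}"

text \<open>The columns belong to the peak indices of \<open>u\<close>, in increasing order. The matrix
  is meaningful only for \<open>u \<noteq> 0\<close>: every index is a peak index of \<open>0\<close>, and the value
  for \<open>u = 0\<close> is an \<open>n \<times> 0\<close> matrix by the conventions for \<^const>\<open>card\<close>.\<close>

definition peak_matrix :: "nat \<Rightarrow> (nat \<Rightarrow> c0) \<Rightarrow> c0 \<Rightarrow> real Matrix.mat" where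
  "peak_matrix n v u =
     Matrix.mat n (card (peak_indices u))
       (\<lambda>(i, j). c0_nth (v i) (sorted_list_of_set (peak_indices u) ! j))"

end

theory Submission
  imports Defs
begin

text \<open>
  Write \<open>N\<close> for the norm of \<open>vhat\<close>. A sequence in \<open>N \<cdot> co (peak_units vhat)\<close> has
  norm at most \<open>N\<close> and pairs with \<open>vhat\<close> to \<open>N\<^sup>2\<close>. Since \<open>vhat\<close> lies in the span of the
  \<open>v i\<close>, its pairing takes the same value \<open>N\<^sup>2\<close> on all interpolants, so that the Hoelder
  inequality makes \<open>N\<close> the minimal norm, and the minimal norm interpolants are those
  interpolants for which \<open>vhat\<close> attains equality in the Hoelder inequality
  (\<open>min_norm_interpolants_iff\<close>). Equality holds termwise: a minimal norm interpolant
  vanishes off the peak indices of \<open>vhat\<close>, and elsewhere it has the sign of \<open>vhat\<close>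
  (\<open>duality_pairing_eq_iff\<close>). If \<open>vhat\<close> were \<open>0\<close>, the zero sequence would interpolate \<open>y\<close>;
  so \<open>vhat\<close> is a nonzero null sequence, its peaks are finitely many, and a minimal norm
  interpolant has finite support.

  If the columns of the peak matrix indexed by the support of a minimal norm interpolant \<open>x\<close>
  had a nontrivial linear relation \<open>c\<close>, then \<open>x + t c\<close> and \<open>x - t c\<close> would still interpolate;
  for small \<open>t > 0\<close> the signs on the support do not change, so both would still attain
  equality with \<open>vhat\<close> and be minimal, which makes \<open>x\<close> a proper midpoint
  (\<open>extreme_point_columns_independent\<close>). At an extreme point these columns are therefore
  linearly independent, and the size of the support is at most the rank
  (\<open>card_le_rank_if_columns_independent\<close>).
\<close>

section \<open>The pairing of null sequences with summable sequences\<close>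

lemma abs_c0_nth_le_norm: "\<bar>c0_nth u j\<bar> \<le> norm u"
  by transfer (auto intro!: cSUP_upper null_seq_bdd_above)

lemma summable_abs_ell1_nth: "summable (\<lambda>j. \<bar>ell1_nth x j\<bar>)"
  using ell1_nth[of x] by simp

lemma summable_duality_pairing: "summable (\<lambda>j. c0_nth u j * ell1_nth x j)"
proof (rule summable_comparison_test')
  show "summable (\<lambda>j. norm u * \<bar>ell1_nth x j\<bar>)"
    by (intro summable_mult summable_abs_ell1_nth)
  show "norm (c0_nth u j * ell1_nth x j) \<le> norm u * \<bar>ell1_nth x j\<bar>" for j
    by (simp add: abs_mult mult_right_mono abs_c0_nth_le_norm)
qed

lemma linear_duality_pairing_left: "linear (\<lambda>u. duality_pairing u x)"
  unfolding duality_pairing_def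
  by (rule linearI)
    (simp_all add: plus_c0.rep_eq scaleR_c0.rep_eq distrib_right suminf_add
      summable_duality_pairing mult.assoc suminf_mult)

lemma linear_duality_pairing: "linear (duality_pairing u)"
  unfolding duality_pairing_def
  by (rule linearI)
    (simp_all add: plus_ell1.rep_eq scaleR_ell1.rep_eq distrib_left suminf_add
      summable_duality_pairing mult.left_commute suminf_mult)

text \<open>All terms of \<open>norm u * norm x - duality_pairing u x\<close> are nonnegative, which gives both
  the Hoelder inequality and its equality case.\<close>

lemma hoelder_gap_sums:
  "(\<lambda>j. norm u * \<bar>ell1_nth x j\<bar> - c0_nth u j * ell1_nth x j)
     sums (norm u * norm x - duality_pairing u x)"
  unfolding duality_pairing_def norm_ell1.rep_eq
  by (intro sums_diff sums_mult summable_sums summable_abs_ell1_nth summable_duality_pairing)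

lemma hoelder_gap_term_nonneg: "0 \<le> norm u * \<bar>ell1_nth x j\<bar> - c0_nth u j * ell1_nth x j"
proof -
  have "c0_nth u j * ell1_nth x j \<le> \<bar>c0_nth u j\<bar> * \<bar>ell1_nth x j\<bar>"
    by (metis abs_ge_self abs_mult)
  also have "\<dots> \<le> norm u * \<bar>ell1_nth x j\<bar>"
    by (intro mult_right_mono abs_c0_nth_le_norm) simp
  finally show ?thesis by simp
qed

lemma duality_pairing_le: "duality_pairing u x \<le> norm u * norm x"
  using sums_le[OF hoelder_gap_term_nonneg sums_zero hoelder_gap_sums, of u x] by simp

lemma duality_pairing_eq_iff:
  "duality_pairing u x = norm u * norm x \<longleftrightarrow>
     (\<forall>j. c0_nth u j * ell1_nth x j = norm u * \<bar>ell1_nth x j\<bar>)"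
proof -
  have "norm u * norm x - duality_pairing u x = 0 \<longleftrightarrow>
      (\<forall>j. norm u * \<bar>ell1_nth x j\<bar> - c0_nth u j * ell1_nth x j = 0)"
    unfolding sums_unique[OF hoelder_gap_sums]
    by (rule suminf_eq_zero_iff[OF sums_summable[OF hoelder_gap_sums] hoelder_gap_term_nonneg])
  then show ?thesis by auto
qed

section \<open>Peaks and finitely supported sequences\<close>

lemma finite_peak_indices:
  assumes "u \<noteq> 0"
  shows "finite (peak_indices u)"
proof -
  have "c0_nth u \<longlonglongrightarrow> 0"
    using c0_nth[of u] by simp
  moreover have "0 < norm u"
    using assms by simp
  ultimately obtain m where "\<And>j. j \<ge> m \<Longrightarrow> \<bar>c0_nth u j\<bar> < norm u"
    unfolding LIMSEQ_iff by fastforce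
  then have "peak_indices u \<subseteq> {..<m}"
    unfolding peak_indices_def by (force simp: not_less[symmetric])
  then show ?thesis
    by (rule finite_subset) simp
qed

text \<open>At a nonzero entry of \<open>x\<close>, taking absolute values in the termwise equality and
  cancelling \<open>\<bar>ell1_nth x j\<bar>\<close> leaves the peak condition.\<close>

lemma peak_if_hoelder_equality:
  assumes "duality_pairing u x = norm u * norm x" and "ell1_nth x j \<noteq> 0"
  shows "j \<in> peak_indices u"
proof -
  have "c0_nth u j * ell1_nth x j = norm u * \<bar>ell1_nth x j\<bar>"
    using assms(1) by (simp add: duality_pairing_eq_iff)
  then have "\<bar>c0_nth u j\<bar> * \<bar>ell1_nth x j\<bar> = norm u * \<bar>ell1_nth x j\<bar>"
    by (metis abs_abs abs_mult abs_norm_cancel)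
  with assms(2) show ?thesis
    by (simp add: peak_indices_def)
qed

lemma ell1_nth_sum: "ell1_nth (\<Sum>k\<in>T. f k) j = (\<Sum>k\<in>T. ell1_nth (f k) j)"
  by (induction T rule: infinite_finite_induct) (simp_all add: zero_ell1.rep_eq plus_ell1.rep_eq)

lemma ell1_nth_sum_units:
  assumes "finite T"
  shows "ell1_nth (\<Sum>k\<in>T. c k *\<^sub>R unit_ell1 k) j = (if j \<in> T then c j else 0)"
proof -
  have "ell1_nth (\<Sum>k\<in>T. c k *\<^sub>R unit_ell1 k) j = (\<Sum>k\<in>T. if k = j then c k else 0)"
    by (auto simp: ell1_nth_sum scaleR_ell1.rep_eq unit_ell1.rep_eq intro!: sum.cong)
  then show ?thesis
    using assms by simp
qed

lemma norm_ell1_finite_support: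
  assumes "finite T" and "\<And>j. j \<notin> T \<Longrightarrow> ell1_nth x j = 0"
  shows "norm x = (\<Sum>j\<in>T. \<bar>ell1_nth x j\<bar>)"
  unfolding norm_ell1.rep_eq by (rule suminf_finite) (use assms in auto)

lemma duality_pairing_sum_units:
  assumes "finite T"
  shows "duality_pairing u (\<Sum>k\<in>T. c k *\<^sub>R unit_ell1 k) = (\<Sum>k\<in>T. c k * c0_nth u k)"
proof -
  have "duality_pairing u (\<Sum>k\<in>T. c k *\<^sub>R unit_ell1 k)
      = (\<Sum>j\<in>T. c0_nth u j * ell1_nth (\<Sum>k\<in>T. c k *\<^sub>R unit_ell1 k) j)"
    unfolding duality_pairing_def
    by (rule suminf_finite) (use assms in \<open>auto simp: ell1_nth_sum_units\<close>)
  then show ?thesis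
    using assms by (simp add: ell1_nth_sum_units mult.commute)
qed

lemma norm_unit_ell1: "norm (unit_ell1 j) = 1"
  using norm_ell1_finite_support[of "{j}" "unit_ell1 j"] by (simp add: unit_ell1.rep_eq)

lemma duality_pairing_unit: "duality_pairing u (unit_ell1 j) = c0_nth u j"
  using duality_pairing_sum_units[of "{j}" u "\<lambda>_. 1"] by simp

text \<open>Both properties hold for the signed units and cut out a convex set.\<close>

lemma convex_hull_peak_units:
  assumes "p \<in> convex hull (peak_units u)"
  shows "norm p \<le> 1" and "duality_pairing u p = norm u"
proof -
  interpret linear "duality_pairing u" by (rule linear_duality_pairing)
  let ?H = "cball 0 1 \<inter> {p. duality_pairing u p = norm u}"
  have "convex {p. duality_pairing u p = norm u}"
    by (rule convexI) (simp add: add scale flip: distrib_right)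
  then have "convex ?H"
    by (intro convex_Int convex_cball)
  have "sgn (c0_nth u j) *\<^sub>R unit_ell1 j \<in> ?H" if "\<bar>c0_nth u j\<bar> = norm u" for j
    using that by (simp add: scale norm_unit_ell1 duality_pairing_unit abs_sgn_eq
        sgn_mult_self_eq abs_sgn mult.commute)
  then have units: "peak_units u \<subseteq> ?H"
    by (auto simp: peak_units_def peak_indices_def)
  have "convex hull (peak_units u) \<subseteq> ?H"
    by (rule hull_minimal[of _ _ convex, OF units \<open>convex ?H\<close>])
  with assms show "norm p \<le> 1" "duality_pairing u p = norm u" by auto
qed

section \<open>Minimal norm interpolants\<close>

lemma interpolants_add:
  assumes "x \<in> interpolants n v y" and "\<And>i. i < n \<Longrightarrow> duality_pairing (v i) d = 0"
  shows "x + d \<in> interpolants n v y"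
  using assms by (simp add: interpolants_def linear_add[OF linear_duality_pairing])

text \<open>The difference of two interpolants is annihilated by every \<open>v i\<close>, hence by their span.\<close>

lemma duality_pairing_span_interpolants:
  assumes "u \<in> span (v ` {..<n})" and "x \<in> interpolants n v y" and "z \<in> interpolants n v y"
  shows "duality_pairing u x = duality_pairing u z"
proof -
  have "duality_pairing b (x - z) = 0" if "b \<in> v ` {..<n}" for b
    using that assms(2,3) by (auto simp: interpolants_def linear_diff[OF linear_duality_pairing])
  then have "duality_pairing u (x - z) = 0"
    by (rule linear_eq_0_on_span[OF linear_duality_pairing_left _ assms(1)])
  then show ?thesis
    by (simp add: linear_diff[OF linear_duality_pairing])
qed

text \<open>The interpolant in the scaled convex hull certifies that the minimal norm is
  \<open>norm u\<close>: it has at most this norm, and \<open>u\<close> bounds the norm of all others from below.\<close>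

lemma min_norm_interpolants_iff:
  assumes span: "u \<in> span (v ` {..<n})" and "u \<noteq> 0"
    and meets: "(*\<^sub>R) (norm u) ` (convex hull (peak_units u)) \<inter> interpolants n v y \<noteq> {}"
  shows "z \<in> min_norm_interpolants n v y \<longleftrightarrow>
      z \<in> interpolants n v y \<and> norm z = norm u"
    and "z \<in> interpolants n v y \<Longrightarrow> duality_pairing u z = norm u * norm u"
proof -
  obtain p where p: "p \<in> convex hull (peak_units u)"
    and w: "norm u *\<^sub>R p \<in> interpolants n v y"
    using meets by blast
  have pairing: "duality_pairing u z = norm u * norm u" if "z \<in> interpolants n v y" for z
    using duality_pairing_span_interpolants[OF span that w] convex_hull_peak_units(2)[OF p]
    by (simp add: linear_scale[OF linear_duality_pairing])
  have lower: "norm u \<le> norm z" if "z \<in> interpolants n v y" for z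
    using duality_pairing_le[of u z] pairing[OF that] \<open>u \<noteq> 0\<close> by simp
  have "norm (norm u *\<^sub>R p) \<le> norm u"
    using convex_hull_peak_units(1)[OF p] by (simp add: mult_left_le)
  with lower[OF w] have "norm (norm u *\<^sub>R p) = norm u" by linarith
  then have "(INF z\<in>interpolants n v y. norm z) = norm u"
    by (intro cInf_eq_minimum) (use w lower in \<open>force+\<close>)
  then show "z \<in> min_norm_interpolants n v y \<longleftrightarrow>
      z \<in> interpolants n v y \<and> norm z = norm u"
    by (simp add: min_norm_interpolants_def)
  show "z \<in> interpolants n v y \<Longrightarrow> duality_pairing u z = norm u * norm u"
    by (rule pairing)
qed

section \<open>Independence of the columns at an extreme point\<close>

text \<open>A perturbation that is dominated by \<open>x\<close> can shrink entries of \<open>x\<close> to zero but cannot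
  flip their signs, so termwise equality with \<open>u\<close> survives.\<close>

lemma hoelder_equality_dominated_perturbation:
  assumes eq: "duality_pairing u x = norm u * norm x"
    and dom: "\<And>j. \<bar>ell1_nth d j\<bar> \<le> \<bar>ell1_nth x j\<bar>"
  shows "duality_pairing u (x + d) = norm u * norm (x + d)"
  unfolding duality_pairing_eq_iff
proof
  fix j
  let ?a = "c0_nth u j" and ?x = "ell1_nth x j" and ?d = "ell1_nth d j"
  have a: "?a * ?x = norm u * \<bar>?x\<bar>"
    using eq by (simp add: duality_pairing_eq_iff)
  have "?a * (?x + ?d) = norm u * \<bar>?x + ?d\<bar>"
  proof (cases "?x" "0 :: real" rule: linorder_cases)
    case less
    then have "?a = - norm u" using a mult_right_cancel[of ?x ?a "- norm u"] by simp
    moreover have "?x + ?d \<le> 0" using less dom[of j] by linarith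
    ultimately show ?thesis by (simp add: algebra_simps)
  next
    case equal
    then show ?thesis using dom[of j] by simp
  next
    case greater
    then have "?a = norm u" using a mult_right_cancel[of ?x ?a "norm u"] by simp
    moreover have "?x + ?d \<ge> 0" using greater dom[of j] by linarith
    ultimately show ?thesis by simp
  qed
  then show "c0_nth u j * ell1_nth (x + d) j = norm u * \<bar>ell1_nth (x + d) j\<bar>"
    by (simp add: plus_ell1.rep_eq)
qed

text \<open>A relation between the columns is a direction in the kernel of the interpolation
  conditions that is supported where \<open>x\<close> is nonzero. A small step along it, forwards or
  backwards, is dominated by \<open>x\<close> and therefore keeps the norm minimal; extremality leaves
  only the step zero.\<close>

lemma extreme_point_columns_independent:
  assumes "u \<in> span (v ` {..<n})" and "u \<noteq> 0"
    and "(*\<^sub>R) (norm u) ` (convex hull (peak_units u)) \<inter> interpolants n v y \<noteq> {}"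
    and extreme: "x extreme_point_of (min_norm_interpolants n v y)"
    and T: "finite T" "\<And>j. j \<in> T \<Longrightarrow> ell1_nth x j \<noteq> 0"
    and relation: "\<And>i. i < n \<Longrightarrow> (\<Sum>k\<in>T. c k * c0_nth (v i) k) = 0"
    and "j \<in> T"
  shows "c j = 0"
proof -
  note minimal = min_norm_interpolants_iff[OF assms(1-3)]
  have x: "x \<in> interpolants n v y" "norm x = norm u"
    using extreme by (simp_all add: extreme_point_of_def minimal(1))
  then have eq: "duality_pairing u x = norm u * norm x"
    by (simp add: minimal(2))
  \<comment> \<open>\<open>s\<close> exceeds every ratio of \<open>\<bar>c k\<bar>\<close> to \<open>\<bar>x k\<bar>\<close>, so dividing \<open>c\<close> by it makes \<open>x\<close> dominate.\<close>
  define s where "s = 1 + (\<Sum>k\<in>T. \<bar>c k\<bar> / \<bar>ell1_nth x k\<bar>)"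
  have "0 < s"
    unfolding s_def by (intro add_pos_nonneg sum_nonneg) auto
  have dom: "\<bar>c k / s\<bar> \<le> \<bar>ell1_nth x k\<bar>" if "k \<in> T" for k
  proof -
    have "\<bar>c k\<bar> / \<bar>ell1_nth x k\<bar> \<le> (\<Sum>k\<in>T. \<bar>c k\<bar> / \<bar>ell1_nth x k\<bar>)"
      by (rule member_le_sum) (use that T(1) in auto)
    then have "\<bar>c k\<bar> / \<bar>ell1_nth x k\<bar> \<le> s"
      by (simp add: s_def)
    then show ?thesis
      using T(2)[OF that] \<open>0 < s\<close> by (simp add: field_simps)
  qed
  define d where "d = (\<Sum>k\<in>T. (c k / s) *\<^sub>R unit_ell1 k)"
  have d_nth: "ell1_nth d k = (if k \<in> T then c k / s else 0)" for k
    unfolding d_def by (rule ell1_nth_sum_units[OF T(1)])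
  have d_null: "duality_pairing (v i) d = 0" if "i < n" for i
    unfolding d_def duality_pairing_sum_units[OF T(1)]
    using relation[OF that] by (simp flip: sum_divide_distrib)
  have d_dom: "\<bar>ell1_nth d k\<bar> \<le> \<bar>ell1_nth x k\<bar>" for k
    using dom by (simp add: d_nth)
  have stays_minimal: "x + e \<in> min_norm_interpolants n v y"
    if "\<And>i. i < n \<Longrightarrow> duality_pairing (v i) e = 0"
      and "\<And>k. \<bar>ell1_nth e k\<bar> \<le> \<bar>ell1_nth x k\<bar>" for e
  proof -
    have "x + e \<in> interpolants n v y"
      by (rule interpolants_add[OF x(1) that(1)])
    moreover from this have "norm (x + e) = norm u"
      using hoelder_equality_dominated_perturbation[OF eq that(2)] \<open>u \<noteq> 0\<close>
      by (simp add: minimal(2))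
    ultimately show ?thesis by (simp add: minimal(1))
  qed
  have "x + d \<in> min_norm_interpolants n v y"
    by (rule stays_minimal[OF d_null d_dom])
  moreover have "x - d \<in> min_norm_interpolants n v y"
    using stays_minimal[of "- d"]
    by (simp add: d_null d_dom linear_neg[OF linear_duality_pairing] uminus_ell1.rep_eq)
  moreover have "x = midpoint (x + d) (x - d)"
    by (simp add: midpoint_def flip: scaleR_2)
  ultimately have "x + d = x - d"
    using extreme midpoint_in_open_segment unfolding extreme_point_of_def by metis
  then have "ell1_nth (x + d) j = ell1_nth (x - d) j" by (rule arg_cong)
  then show ?thesis
    using \<open>j \<in> T\<close> \<open>0 < s\<close> by (simp add: plus_ell1.rep_eq minus_ell1.rep_eq d_nth)
qed

section \<open>Independent columns and rank\<close>

text \<open>Independence is assumed of the family \<open>w\<close> rather than of the set of its values. It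
  thereby includes injectivity: two equal members would satisfy the relation with
  coefficients \<open>1\<close> and \<open>-1\<close>. The columns can thus be indexed by the support itself,
  without its position in the enumeration of the peak indices.\<close>

lemma (in vec_space) card_le_rank_if_columns_independent:
  fixes w :: "'b \<Rightarrow> 'a Matrix.vec"
  assumes A: "A \<in> carrier_mat n nc" and "finite T"
    and columns: "\<And>t. t \<in> T \<Longrightarrow> w t \<in> set (cols A)"
    and indep: "\<And>c t. (\<And>i. i < n \<Longrightarrow> (\<Sum>t\<in>T. c t * (w t $ i)) = 0) \<Longrightarrow> t \<in> T \<Longrightarrow> c t = 0"
  shows "card T \<le> rank A"
proof -
  have carrier: "w ` T \<subseteq> carrier_vec n"
    using columns cols_dim[of A] A by auto
  have inj: "inj_on w T"
  proof (rule inj_onI, rule ccontr)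
    fix s t assume st: "s \<in> T" "t \<in> T" "w s = w t" "s \<noteq> t"
    let ?c = "\<lambda>r. (if r = s then 1 else 0) - (if r = t then 1 else 0) :: 'a"
    have "(\<Sum>r\<in>T. ?c r * (w r $ i)) = 0" for i
    proof -
      have "(\<Sum>r\<in>T. ?c r * (w r $ i))
          = (\<Sum>r\<in>T. (if r = s then w s $ i else 0) - (if r = t then w t $ i else 0))"
        by (rule sum.cong) auto
      also have "\<dots> = 0"
        unfolding sum_subtractf using st \<open>finite T\<close> by simp
      finally show ?thesis .
    qed
    then have "?c s = 0"
      by (rule indep) (rule st(1))
    with st(4) show False by simp
  qed
  have trivial: "a b = 0" if "lincomb a (w ` T) = 0\<^sub>v n" "b \<in> w ` T" for a b
  proof -
    have "(\<Sum>t\<in>T. a (w t) * (w t $ i)) = 0" if "i < n" for i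
      using lincomb_index[OF that carrier, of a] \<open>lincomb a (w ` T) = 0\<^sub>v n\<close> that
      by (simp add: sum.reindex[OF inj])
    then have "a (w t) = 0" if "t \<in> T" for t
      using that by (rule indep[of "\<lambda>t. a (w t)"])
    then show ?thesis
      using that(2) by blast
  qed
  have "lin_indpt (w ` T)"
    by (rule finite_lin_indpt2)
      (use \<open>finite T\<close> carrier trivial in \<open>auto simp: module_vec_simps class_ring_simps\<close>)
  moreover have "w ` T \<subseteq> set (cols A)"
    using columns by auto
  ultimately have "card (w ` T) \<le> rank A"
    using rank_ge_card_indpt[OF A] by blast
  then show ?thesis
    by (simp add: card_image[OF inj])
qed

lemma peak_matrix_column:
  assumes "finite (peak_indices u)" and "k \<in> peak_indices u"
  shows "Matrix.vec n (\<lambda>i. c0_nth (v i) k) \<in> set (cols (peak_matrix n v u))"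
proof -
  obtain j where j: "j < card (peak_indices u)" "sorted_list_of_set (peak_indices u) ! j = k"
    using assms by (metis in_set_conv_nth length_sorted_list_of_set set_sorted_list_of_set)
  have "col (peak_matrix n v u) j = Matrix.vec n (\<lambda>i. c0_nth (v i) k)"
    using j by (intro eq_vecI) (auto simp: peak_matrix_def)
  moreover have "col (peak_matrix n v u) j \<in> set (cols (peak_matrix n v u))"
    using j(1) by (auto simp: cols_def peak_matrix_def)
  ultimately show ?thesis by simp
qed

section \<open>Representation of the extreme points\<close>

theorem theorem17:
  fixes n :: nat
    and v :: "nat \<Rightarrow> c0"
    and y :: "real Matrix.vec"
    and vhat :: c0
    and xhat :: ell1
  assumes lin_indep: "inj_on v {..<n}" "independent (v ` {..<n})"
    and y: "y \<in> carrier_vec n" "y \<noteq> 0\<^sub>v n"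
    and vhat_span: "vhat \<in> span (v ` {..<n})"
    and vhat_meets: "(*\<^sub>R) (norm vhat) ` (convex hull (peak_units vhat)) \<inter> interpolants n v y \<noteq> {}"
    and xhat: "xhat extreme_point_of (min_norm_interpolants n v y)"
  shows "\<exists>(M::nat) (\<alpha> :: nat \<Rightarrow> real) (k :: nat \<Rightarrow> nat).
           0 < M \<and> M \<le> vec_space.rank n (peak_matrix n v vhat) \<and>
           (\<forall>j<M. \<alpha> j \<noteq> 0) \<and>
           (\<Sum>j<M. \<bar>\<alpha> j\<bar>) = norm vhat \<and>
           (\<forall>j<M. k j \<in> peak_indices vhat) \<and>
           xhat = (\<Sum>j<M. \<alpha> j *\<^sub>R unit_ell1 (k j))"
proof -
  obtain p where p: "norm vhat *\<^sub>R p \<in> interpolants n v y"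
    using vhat_meets by blast
  have "vhat \<noteq> 0"
  proof
    assume "vhat = 0"
    with p have "y = 0\<^sub>v n"
      using y(1) by (auto simp: interpolants_def linear_0[OF linear_duality_pairing])
    with y(2) show False by simp
  qed
  note minimal = min_norm_interpolants_iff[OF vhat_span \<open>vhat \<noteq> 0\<close> vhat_meets]
  have "xhat \<in> interpolants n v y" and norm_xhat: "norm xhat = norm vhat"
    using xhat by (simp_all add: extreme_point_of_def minimal(1))
  then have eq: "duality_pairing vhat xhat = norm vhat * norm xhat"
    by (simp add: minimal(2))
  define T where "T = {j. ell1_nth xhat j \<noteq> 0}"
  have peaks: "T \<subseteq> peak_indices vhat"
    using peak_if_hoelder_equality[OF eq] by (auto simp: T_def)
  have finite_peaks: "finite (peak_indices vhat)"
    by (rule finite_peak_indices[OF \<open>vhat \<noteq> 0\<close>])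
  then have "finite T"
    using peaks by (rule rev_finite_subset)
  have expansion: "xhat = (\<Sum>k\<in>T. ell1_nth xhat k *\<^sub>R unit_ell1 k)"
    by (rule ell1_eqI) (simp add: ell1_nth_sum_units[OF \<open>finite T\<close>], simp add: T_def)
  have norm_sum: "norm xhat = (\<Sum>k\<in>T. \<bar>ell1_nth xhat k\<bar>)"
    by (rule norm_ell1_finite_support[OF \<open>finite T\<close>]) (simp add: T_def)
  have "T \<noteq> {}"
    using norm_sum norm_xhat \<open>vhat \<noteq> 0\<close> by auto
  have rank: "card T \<le> vec_space.rank n (peak_matrix n v vhat)"
  proof (rule vec_space.card_le_rank_if_columns_independent[OF _ \<open>finite T\<close>])
    show "peak_matrix n v vhat \<in> carrier_mat n (card (peak_indices vhat))"
      by (simp add: peak_matrix_def)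
    show "Matrix.vec n (\<lambda>i. c0_nth (v i) k) \<in> set (cols (peak_matrix n v vhat))" if "k \<in> T" for k
      using peak_matrix_column[OF finite_peaks] peaks that by blast
    fix c j
    assume "\<And>i. i < n \<Longrightarrow> (\<Sum>k\<in>T. c k * (Matrix.vec n (\<lambda>i. c0_nth (v i) k) $ i)) = 0"
      and "j \<in> T"
    then show "c j = 0"
      using extreme_point_columns_independent[OF vhat_span \<open>vhat \<noteq> 0\<close> vhat_meets xhat \<open>finite T\<close>, of c j]
      by (simp add: T_def)
  qed
  obtain k where k: "bij_betw k {..<card T} T"
    using ex_bij_betw_nat_finite[OF \<open>finite T\<close>] by (auto simp: atLeast0LessThan)
  have k_mem: "k j \<in> T" if "j < card T" for j
    using bij_betwE[OF k] that by blast
  show ?thesis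
  proof (intro exI conjI)
    show "0 < card T"
      using \<open>T \<noteq> {}\<close> \<open>finite T\<close> by (simp add: card_gt_0_iff)
    show "card T \<le> vec_space.rank n (peak_matrix n v vhat)"
      by (rule rank)
    show "\<forall>j<card T. ell1_nth xhat (k j) \<noteq> 0"
      using k_mem by (simp add: T_def)
    show "\<forall>j<card T. k j \<in> peak_indices vhat"
      using k_mem peaks by blast
    show "(\<Sum>j<card T. \<bar>ell1_nth xhat (k j)\<bar>) = norm vhat"
      using norm_sum norm_xhat sum.reindex_bij_betw[OF k, of "\<lambda>j. \<bar>ell1_nth xhat j\<bar>"] by simp
    show "xhat = (\<Sum>j<card T. ell1_nth xhat (k j) *\<^sub>R unit_ell1 (k j))"
      unfolding sum.reindex_bij_betw[OF k, of "\<lambda>j. ell1_nth xhat j *\<^sub>R unit_ell1 j"]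
      by (rule expansion)
  qed
qed

end
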